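(* For all real numbers $r>0$ and $s>0$, $$\frac{\pi}{8}\sqrt{\frac{8rs(r^2+s^2)-(s^2-r^2)^2}{rs}}\le \varepsilon(r,s)\le \frac{\pi}{8}\sqrt{\frac{8rs(r^2+s^2)+(s^2-r^2)^2}{rs}}.$$
   Context: For real numbers $r,s>0$, the two-parameter complete elliptic integral of the second kind is $$\varepsilon(r,s)=\int_0^{\pi/2}\sqrt{r^2\cos^2 t+s^2\sin^2 t}\,dt.$$ *)

theory Defs
  imports "HOL-Analysis.Analysis"
begin

(* The two-parameter complete elliptic integral of the second kind.
   Pitfall for bounds on it: a lower bound sqrt x with x < 0 is negative here, since
   sqrt x = - sqrt (- x), and then carries no information. *)
definition ellint2 :: "real \<Rightarrow> real \<Rightarrow> real" where
  "ellint2 r s = integral {0..pi/2} (\<lambda>t. sqrt (r\<^sup>2 * (cos t)\<^sup>2 + s\<^sup>2 * (sin t)\<^sup>2))"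

end

theory Submission
  imports Defs
begin

text \<open>
  Let \<open>f\<close> be the integrand, \<open>M\<close> its mean over \<open>[0, \<pi>/2]\<close>, and \<open>c\<^sup>2 = (r\<^sup>2 + s\<^sup>2)/2\<close>, the mean of \<open>f\<^sup>2\<close>.
  The mean of \<open>(f - c)\<^sup>2\<close> is \<open>2 c (c - M)\<close>; it is nonnegative, which gives the upper bound even
  without the term \<open>(s\<^sup>2 - r\<^sup>2)\<^sup>2\<close>. Moreover \<open>f - c = (f\<^sup>2 - c\<^sup>2)/(f + c)\<close> with
  \<open>f\<^sup>2 - c\<^sup>2 = - (s\<^sup>2 - r\<^sup>2)/2 \<cdot> cos 2t\<close> and \<open>(f + c)\<^sup>2 \<ge> 2 r s\<close>, so that mean is at most
  \<open>V = (s\<^sup>2 - r\<^sup>2)\<^sup>2/(16 r s)\<close>. The lower bound then follows from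
  \<open>M\<^sup>2 \<ge> 2 c M - c\<^sup>2 \<ge> c\<^sup>2 - V\<close>.
\<close>

text \<open>The antiderivatives of the cosine terms vanish at both endpoints, so only the constant
  term of such a majorant or minorant of the integrand survives.\<close>

lemma has_integral_cos_2_4:
  fixes a b d :: real
  shows "((\<lambda>t. a + b * cos (2 * t) + d * cos (4 * t)) has_integral a * pi / 2) {0..pi/2}"
proof -
  have "((\<lambda>t. a + b * cos (2 * t) + d * cos (4 * t)) has_integral
      (\<lambda>t. a * t + b * sin (2 * t) / 2 + d * sin (4 * t) / 4) (pi / 2)
      - (\<lambda>t. a * t + b * sin (2 * t) / 2 + d * sin (4 * t) / 4) 0) {0..pi/2}"
    by (intro fundamental_theorem_of_calculus)
      (auto intro!: derivative_eq_intros simp flip: has_real_derivative_iff_has_vector_derivative)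
  moreover have "sin (4 * (pi / 2)) = 0"
    by simp
  ultimately show ?thesis
    by simp
qed

text \<open>With \<open>a\<close> the smaller and \<open>b\<close> the larger of \<open>r\<close>
  and \<open>s\<close>, both \<open>f\<close> and \<open>c\<close> are at least \<open>a\<close>.
  Hence the square is at least \<open>3 * a\<^sup>2 + c\<^sup>2\<close>, which is at least
  \<open>(4 * a\<^sup>2 + b\<^sup>2) / 2\<close>, and \<open>(2 * a - b)\<^sup>2 \<ge> 0\<close>
  finishes.\<close>

lemma sum_quadratic_mean_square_ge:
  fixes r s c f :: real
  assumes "r > 0" "s > 0" "c > 0" and "c\<^sup>2 = (r\<^sup>2 + s\<^sup>2) / 2" and "min r s \<le> f"
  shows "2 * r * s \<le> (f + c)\<^sup>2"
proof -
  have *: "2 * a * b \<le> (f + c)\<^sup>2"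
    if "0 < a" "a \<le> b" "a \<le> f" "c\<^sup>2 = (a\<^sup>2 + b\<^sup>2) / 2" for a b
  proof -
    have c2: "2 * c\<^sup>2 = a\<^sup>2 + b\<^sup>2"
      using that(4) by simp
    have "a\<^sup>2 \<le> b\<^sup>2"
      using that by (intro power_mono) auto
    with c2 have "a\<^sup>2 \<le> c\<^sup>2"
      by linarith
    then have "a \<le> c"
      by (rule power2_le_imp_le) (use \<open>c > 0\<close> in simp)
    have "a * a \<le> f * c"
      using that \<open>a \<le> c\<close> by (intro mult_mono) auto
    moreover have "a\<^sup>2 \<le> f\<^sup>2"
      using that by (intro power_mono) auto
    moreover have "0 \<le> (2 * a - b)\<^sup>2" "0 \<le> a\<^sup>2"
      by simp_all
    moreover have "(2 * a - b)\<^sup>2 = 4 * a\<^sup>2 - 2 * (2 * a * b) + b\<^sup>2"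
      "(f + c)\<^sup>2 = f\<^sup>2 + 2 * (f * c) + c\<^sup>2" "a * a = a\<^sup>2"
      by (simp_all add: power2_eq_square algebra_simps)
    ultimately show ?thesis
      using c2 by linarith
  qed
  show ?thesis
  proof (cases "r \<le> s")
    case True
    then show ?thesis
      using *[of r s] assms by simp
  next
    case False
    then have "2 * s * r \<le> (f + c)\<^sup>2"
      using assms by (intro *) auto
    then show ?thesis
      by (simp add: mult_ac)
  qed
qed

text \<open>\<open>u\<close> is the tangent line of the square root at \<open>c\<^sup>2\<close>,
  taken at \<open>f\<^sup>2\<close>, so it lies above \<open>f\<close>. The gap is exactly
  \<open>(f - c)\<^sup>2 / (2 * c)\<close>; the constant \<open>k\<close> is the mean of the bound
  on this gap.\<close>

lemma ellint2_integrand_bounds: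
  fixes r s c t :: real
  assumes "r > 0" "s > 0" "c > 0" and c: "c\<^sup>2 = (r\<^sup>2 + s\<^sup>2) / 2"
  defines "f \<equiv> sqrt (r\<^sup>2 * (cos t)\<^sup>2 + s\<^sup>2 * (sin t)\<^sup>2)"
    and "u \<equiv> c - (s\<^sup>2 - r\<^sup>2) / (4 * c) * cos (2 * t)"
    and "k \<equiv> (s\<^sup>2 - r\<^sup>2)\<^sup>2 / (32 * c * r * s)"
  shows "f \<le> u" and "u - k * (1 + cos (4 * t)) \<le> f"
proof -
  have f2: "f\<^sup>2 = r\<^sup>2 * (cos t)\<^sup>2 + s\<^sup>2 * (sin t)\<^sup>2"
    unfolding f_def by simp
  have sc: "(sin t)\<^sup>2 = (1 - cos (2 * t)) / 2" "(cos t)\<^sup>2 = (1 + cos (2 * t)) / 2"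
    by (simp add: cos_double_sin, simp add: cos_double_cos)
  have dev: "f\<^sup>2 - c\<^sup>2 = - (s\<^sup>2 - r\<^sup>2) / 2 * cos (2 * t)"
    unfolding f2 c sc by (simp add: field_simps)
  have u: "u - f = (f - c)\<^sup>2 / (2 * c)"
  proof -
    have "2 * c * u = 2 * c\<^sup>2 + (f\<^sup>2 - c\<^sup>2)"
      unfolding dev u_def using \<open>c > 0\<close> by (simp add: field_simps power2_eq_square)
    then show ?thesis
      using \<open>c > 0\<close> by (simp add: field_simps power2_eq_square)
  qed
  have "0 \<le> (f - c)\<^sup>2 / (2 * c)"
    using \<open>c > 0\<close> by simp
  then show "f \<le> u"
    using u by linarith
  \<comment> \<open>\<open>f\<^sup>2\<close> is a convex combination of \<open>r\<^sup>2\<close> and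
    \<open>s\<^sup>2\<close>.\<close>
  have "(min r s)\<^sup>2 = (min r s)\<^sup>2 * (cos t)\<^sup>2 + (min r s)\<^sup>2 * (sin t)\<^sup>2"
    by (simp flip: distrib_left)
  also have "\<dots> \<le> f\<^sup>2"
    unfolding f2 using assms(1,2) by (intro add_mono mult_right_mono power_mono) auto
  finally have "min r s \<le> f"
    by (rule power2_le_imp_le) (simp add: f_def)
  then have "2 * r * s \<le> (f + c)\<^sup>2"
    by (rule sum_quadratic_mean_square_ge[OF assms(1-4)])
  then have "(f - c)\<^sup>2 * (2 * r * s) \<le> (f - c)\<^sup>2 * (f + c)\<^sup>2"
    by (intro mult_left_mono) auto
  also have "\<dots> = (f\<^sup>2 - c\<^sup>2)\<^sup>2"
    by (simp add: power2_eq_square algebra_simps)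
  also have "\<dots> = (s\<^sup>2 - r\<^sup>2)\<^sup>2 / 4 * (cos (2 * t))\<^sup>2"
    unfolding dev by (simp add: power_mult_distrib power_divide power2_commute)
  also have "(cos (2 * t))\<^sup>2 = (1 + cos (4 * t)) / 2"
    using cos_double_cos[of "2 * t"] by simp
  finally have "(f - c)\<^sup>2 / (2 * c) \<le> k * (1 + cos (4 * t))"
    unfolding k_def using assms(1-3) by (simp add: field_simps)
  then show "u - k * (1 + cos (4 * t)) \<le> f"
    using u by linarith
qed

theorem theorem3p3:
  fixes r s :: real
  assumes "r > 0" and "s > 0"
  shows "pi / 8 * sqrt ((8 * r * s * (r\<^sup>2 + s\<^sup>2) - (s\<^sup>2 - r\<^sup>2)\<^sup>2) / (r * s)) \<le> ellint2 r s
    \<and> ellint2 r s \<le> pi / 8 * sqrt ((8 * r * s * (r\<^sup>2 + s\<^sup>2) + (s\<^sup>2 - r\<^sup>2)\<^sup>2) / (r * s))"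
proof -
  define c where "c = sqrt ((r\<^sup>2 + s\<^sup>2) / 2)"
  define k where "k = (s\<^sup>2 - r\<^sup>2)\<^sup>2 / (32 * c * r * s)"
  define b where "b = (s\<^sup>2 - r\<^sup>2) / (4 * c)"
  define M where "M = 2 * ellint2 r s / pi"
  have c2: "c\<^sup>2 = (r\<^sup>2 + s\<^sup>2) / 2"
    unfolding c_def by simp
  have "c > 0"
    unfolding c_def using assms by (simp add: add_pos_pos)
  note bounds = ellint2_integrand_bounds[OF assms \<open>c > 0\<close> c2, folded k_def b_def]
  have int: "((\<lambda>t. sqrt (r\<^sup>2 * (cos t)\<^sup>2 + s\<^sup>2 * (sin t)\<^sup>2)) has_integral ellint2 r s) {0..pi/2}"
    unfolding ellint2_def
    by (intro integrable_integral integrable_continuous_real continuous_intros)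
  have "ellint2 r s \<le> c * pi / 2"
    by (rule has_integral_le[OF int has_integral_cos_2_4[of c "- b" 0]]) (use bounds(1) in auto)
  then have M_le: "M \<le> c"
    unfolding M_def by (simp add: field_simps)
  have "(c - k) * pi / 2 \<le> ellint2 r s"
    by (rule has_integral_le[OF has_integral_cos_2_4[of "c - k" "- b" "- k"] int])
      (use bounds(2) in \<open>auto simp: algebra_simps\<close>)
  then have le_M: "c - k \<le> M"
    unfolding M_def by (simp add: field_simps)
  have "ellint2 r s \<ge> 0"
    unfolding ellint2_def by (rule integral_nonneg[OF has_integral_integrable[OF int]]) auto
  then have "M \<ge> 0"
    unfolding M_def by simp
  have E: "ellint2 r s = pi / 8 * (4 * M)"
    unfolding M_def by simp
  have V: "2 * c * k = (s\<^sup>2 - r\<^sup>2)\<^sup>2 / (16 * (r * s))"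
    unfolding k_def using \<open>c > 0\<close> by simp
  \<comment> \<open>Squaring \<open>c - k \<le> M\<close> directly would fail, since
    \<open>c - k\<close> can be negative. Linearizing \<open>M\<^sup>2\<close> at \<open>c\<close>
    avoids this.\<close>
  have "0 \<le> (M - c)\<^sup>2" "2 * c * (c - k) \<le> 2 * c * M"
    using le_M \<open>c > 0\<close> by auto
  then have "c\<^sup>2 - 2 * c * k \<le> M\<^sup>2"
    by (simp add: power2_eq_square algebra_simps)
  then have "(8 * r * s * (r\<^sup>2 + s\<^sup>2) - (s\<^sup>2 - r\<^sup>2)\<^sup>2) / (r * s) \<le> (4 * M)\<^sup>2"
    unfolding V c2 using assms by (simp add: field_simps)
  \<comment> \<open>The radicand may be negative; \<open>sqrt\<close> is monotone on all reals, so
    \<open>M \<ge> 0\<close> suffices.\<close>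
  then have "sqrt ((8 * r * s * (r\<^sup>2 + s\<^sup>2) - (s\<^sup>2 - r\<^sup>2)\<^sup>2) / (r * s)) \<le> 4 * M"
    using \<open>M \<ge> 0\<close> by (intro real_le_lsqrt) auto
  moreover have "4 * M \<le> sqrt ((8 * r * s * (r\<^sup>2 + s\<^sup>2) + (s\<^sup>2 - r\<^sup>2)\<^sup>2) / (r * s))"
  proof (rule real_le_rsqrt)
    have "(4 * M)\<^sup>2 \<le> 16 * c\<^sup>2"
      using M_le \<open>M \<ge> 0\<close> by (simp add: power_mono power_mult_distrib)
    also have "\<dots> \<le> (8 * r * s * (r\<^sup>2 + s\<^sup>2) + (s\<^sup>2 - r\<^sup>2)\<^sup>2) / (r * s)"
      unfolding c2 using assms by (simp add: field_simps)
    finally show "(4 * M)\<^sup>2 \<le> (8 * r * s * (r\<^sup>2 + s\<^sup>2) + (s\<^sup>2 - r\<^sup>2)\<^sup>2) / (r * s)" .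
  qed
  ultimately show ?thesis
    unfolding E by (intro conjI mult_left_mono) auto
qed

end
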